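(* The class of Type $1a$ digraphs is determined by the complementarity spectrum (DCS): for every $n$, if $D$ and $H$ are Type $1a$ digraphs, both with $n$ vertices, and $\Pi(D)=\Pi(H)$, then $D$ and $H$ are isomorphic.
   Context: Digraphs are finite and simple (no loops, no multiple arcs; opposite arcs are allowed). The adjacency matrix $A(D)=(a_{ij})$ of a digraph $D$ has $a_{ij}=1$ if $(i,j)$ is an arc and $a_{ij}=0$ otherwise. A real number $\lambda$ is a complementarity eigenvalue of a real $n\times n$ matrix $A$ if there is a nonzero vector $x\in\mathbb{R}^n$ with $x\ge 0$ (coordinatewise), $Ax\ge\lambda x$ and $\langle x,Ax-\lambda x\rangle=0$. The complementarity spectrum $\Pi(D)$ is the set (not multiset) of complementarity eigenvalues of $A(D)$; it does not depend on the vertex labelling. For integers $r,s\ge 2$, $\infty(r,s)$ is the digraph on $n=r+s-1$ vertices obtained from the directed cycles $\vec C_r$ (vertices $1,\dots,r$, arcs $(k,k+1)$ and $(r,1)$) and $\vec C_s$ (vertices $1',\dots,s'$, arcs $(k',(k+1)')$ and $(s',1')$) by identifying $1$ with $1'$. For integers $2\le r\le s$, $D_{1a}(r,s)$ is obtained from $\infty(r,s)$ by adding the arc $(r,2')$. A Type $1a$ digraph is a digraph isomorphic to some $D_{1a}(r,s)$ with $2\le r\le s$. A class of digraphs is DCS if any two digraphs of the class having the same number of vertices and the same complementarity spectrum are isomorphic. *)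

theory Defs
  imports
    "Graph_Theory.Digraph_Isomorphism"
    "Graph_Theory.Pair_Digraph"
    "Jordan_Normal_Form.Matrix"
begin

definition complementarity_eigenvalue :: "real mat \<Rightarrow> real \<Rightarrow> bool" where
  "complementarity_eigenvalue A \<mu> \<longleftrightarrow> square_mat A \<and>
     (\<exists>x \<in> carrier_vec (dim_row A).
        x \<noteq> 0\<^sub>v (dim_row A) \<and> 0\<^sub>v (dim_row A) \<le> x \<and>
        \<mu> \<cdot>\<^sub>v x \<le> A *\<^sub>v x \<and>
        x \<bullet> (A *\<^sub>v x - \<mu> \<cdot>\<^sub>v x) = 0)"

text \<open>The list \<open>vs\<close> is the vertex labelling: vertex number \<open>i\<close> is \<open>vs ! i\<close>.\<close>

definition adjacency_matrix :: "('a, 'b) pre_digraph \<Rightarrow> 'a list \<Rightarrow> real mat" where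
  "adjacency_matrix D vs =
     mat (length vs) (length vs) (\<lambda>(i, j). if (vs ! i, vs ! j) \<in> arcs_ends D then 1 else 0)"

definition vertex_labelling :: "('a, 'b) pre_digraph \<Rightarrow> 'a list \<Rightarrow> bool" where
  "vertex_labelling D vs \<longleftrightarrow> distinct vs \<and> set vs = verts D"

text \<open>
  All vertex labellings yield the same complementarity eigenvalues (lemma
  \<open>complementarity_spectrum_eq\<close> below), so the existential quantifier over labellings
  picks an arbitrary one.
\<close>

definition complementarity_spectrum :: "('a, 'b) pre_digraph \<Rightarrow> real set" where
  "complementarity_spectrum D =
     {\<mu>. \<exists>vs. vertex_labelling D vs \<and> complementarity_eigenvalue (adjacency_matrix D vs) \<mu>}"

lemma complementarity_eigenvalue_relabel:
  assumes vs: "vertex_labelling D vs" and ws: "vertex_labelling D ws"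
    and ev: "complementarity_eigenvalue (adjacency_matrix D vs) \<mu>"
  shows "complementarity_eigenvalue (adjacency_matrix D ws) \<mu>"
proof -
  define n where "n = length vs"
  have dv: "distinct vs" and dw: "distinct ws" and sets: "set ws = set vs"
    using vs ws by (auto simp: vertex_labelling_def)
  have lw: "length ws = n"
    using dv dw sets unfolding n_def by (metis distinct_card)
  have bv: "bij_betw ((!) vs) {..<n} (set vs)" and bw: "bij_betw ((!) ws) {..<n} (set vs)"
    using bij_betw_nth[OF dv, of "{..<n}" "set vs"] bij_betw_nth[OF dw, of "{..<n}" "set vs"]
      lw sets n_def by auto
  define p where "p = the_inv_into {..<n} ((!) vs) \<circ> (!) ws"
  have bp: "bij_betw p {..<n} {..<n}"
    unfolding p_def using bij_betw_trans[OF bw bij_betw_the_inv_into[OF bv]] .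
  have p: "p i < n" "vs ! p i = ws ! i" if "i < n" for i
  proof -
    show "p i < n" using bp that by (auto simp: bij_betw_def)
    have "ws ! i \<in> (!) vs ` {..<n}" using bv bw that by (auto simp: bij_betw_def)
    then show "vs ! p i = ws ! i"
      using bv by (simp add: p_def f_the_inv_into_f bij_betw_def)
  qed
  let ?A = "adjacency_matrix D vs" and ?B = "adjacency_matrix D ws"
  have A: "?A \<in> carrier_mat n n" and B: "?B \<in> carrier_mat n n"
    by (auto simp: adjacency_matrix_def n_def lw[unfolded n_def])
  obtain x where x: "x \<in> carrier_vec n" "x \<noteq> 0\<^sub>v n" "0\<^sub>v n \<le> x" "\<mu> \<cdot>\<^sub>v x \<le> ?A *\<^sub>v x"
    "x \<bullet> (?A *\<^sub>v x - \<mu> \<cdot>\<^sub>v x) = 0"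
    using ev A by (auto simp: complementarity_eigenvalue_def)
  define y where "y = vec n (\<lambda>i. x $ p i)"
  have y: "y \<in> carrier_vec n" by (simp add: y_def)
  have dims: "dim_row ?A = n" "dim_col ?A = n" "dim_row ?B = n" "dim_col ?B = n"
    "dim_vec x = n" "dim_vec y = n"
    using A B x(1) y by auto
  have AB: "(?B *\<^sub>v y) $ i = (?A *\<^sub>v x) $ p i" if i: "i < n" for i
  proof -
    have "(?B *\<^sub>v y) $ i = (\<Sum>j\<in>{..<n}. ?B $$ (i, j) * y $ j)"
      using i dims by (auto simp: scalar_prod_def lessThan_atLeast0 intro!: sum.cong)
    also have "\<dots> = (\<Sum>j\<in>{..<n}. ?A $$ (p i, p j) * x $ p j)"
      using i p lw n_def by (intro sum.cong) (auto simp: adjacency_matrix_def y_def)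
    also have "\<dots> = (\<Sum>j\<in>{..<n}. ?A $$ (p i, j) * x $ j)"
      by (rule sum.reindex_bij_betw[OF bp])
    also have "\<dots> = (?A *\<^sub>v x) $ p i"
      using p(1)[OF i] dims by (auto simp: scalar_prod_def lessThan_atLeast0 intro!: sum.cong)
    finally show ?thesis .
  qed
  have "y \<noteq> 0\<^sub>v n"
  proof
    assume y0: "y = 0\<^sub>v n"
    have "x $ k = 0" if "k < n" for k
    proof -
      from bp that obtain i where "i < n" "k = p i" by (auto simp: bij_betw_def)
      then show ?thesis using arg_cong[OF y0, of "\<lambda>v. v $ i"] by (simp add: y_def)
    qed
    then have "x = 0\<^sub>v n" using x(1) by (intro eq_vecI) auto
    with x(2) show False ..
  qed
  moreover have "0\<^sub>v n \<le> y" using x(1,3) p by (auto simp: less_eq_vec_def y_def)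
  moreover have "\<mu> \<cdot>\<^sub>v y \<le> ?B *\<^sub>v y"
    using x(4) p AB dims by (auto simp: less_eq_vec_def y_def simp del: index_mult_mat_vec)
  moreover have "y \<bullet> (?B *\<^sub>v y - \<mu> \<cdot>\<^sub>v y) = 0"
  proof -
    have "y \<bullet> (?B *\<^sub>v y - \<mu> \<cdot>\<^sub>v y) = (\<Sum>i\<in>{..<n}. y $ i * ((?B *\<^sub>v y) $ i - \<mu> * y $ i))"
      using dims
      by (auto simp: scalar_prod_def lessThan_atLeast0 simp del: index_mult_mat_vec intro!: sum.cong)
    also have "\<dots> = (\<Sum>i\<in>{..<n}. x $ p i * ((?A *\<^sub>v x) $ p i - \<mu> * x $ p i))"
      using AB by (intro sum.cong) (auto simp: y_def simp del: index_mult_mat_vec)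
    also have "\<dots> = (\<Sum>i\<in>{..<n}. x $ i * ((?A *\<^sub>v x) $ i - \<mu> * x $ i))"
      by (rule sum.reindex_bij_betw[OF bp])
    also have "\<dots> = x \<bullet> (?A *\<^sub>v x - \<mu> \<cdot>\<^sub>v x)"
      using dims
      by (auto simp: scalar_prod_def lessThan_atLeast0 simp del: index_mult_mat_vec intro!: sum.cong)
    finally show ?thesis using x(5) by simp
  qed
  ultimately show ?thesis
    using B y unfolding complementarity_eigenvalue_def by auto
qed

lemma complementarity_spectrum_eq:
  assumes "vertex_labelling D vs"
  shows "complementarity_spectrum D =
    {\<mu>. complementarity_eigenvalue (adjacency_matrix D vs) \<mu>}"
  using assms complementarity_eigenvalue_relabel
  unfolding complementarity_spectrum_def by blast

definition dicycle :: "nat \<Rightarrow> nat pair_pre_digraph" where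
  "dicycle k = \<lparr> pverts = {1..k}, parcs = {(i, i + 1) | i. 1 \<le> i \<and> i < k} \<union> {(k, 1)} \<rparr>"

text \<open>
  The vertices \<open>k\<close> and \<open>k'\<close> of the two cycles are \<open>Inl k\<close> and \<open>Inr k\<close>.
  The map \<open>glue\<close> identifies \<open>1'\<close> with \<open>1\<close>.
\<close>

definition glue :: "nat + nat \<Rightarrow> nat + nat" where
  "glue v = (if v = Inr 1 then Inl 1 else v)"

definition infinity_digraph :: "nat \<Rightarrow> nat \<Rightarrow> (nat + nat) pair_pre_digraph" where
  "infinity_digraph r s =
     \<lparr> pverts = glue ` (Inl ` pverts (dicycle r) \<union> Inr ` pverts (dicycle s)),
       parcs = map_prod glue glue `
         (map_prod Inl Inl ` parcs (dicycle r) \<union> map_prod Inr Inr ` parcs (dicycle s)) \<rparr>"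

definition D1a :: "nat \<Rightarrow> nat \<Rightarrow> (nat + nat) pair_pre_digraph" where
  "D1a r s = (infinity_digraph r s)
     \<lparr> parcs := insert (Inl r, Inr 2) (parcs (infinity_digraph r s)) \<rparr>"

definition Type1a :: "('a, 'b) pre_digraph set" where
  "Type1a = {D. digraph D \<and> (\<exists>r s. 2 \<le> r \<and> r \<le> s \<and> digraph_iso D (with_proj (D1a r s)))}"

lemma pverts_D1a: "pverts (D1a r s) = Inl ` {1..r} \<union> glue ` Inr ` {1..s}"
  by (auto simp: D1a_def infinity_digraph_def dicycle_def glue_def)

lemma card_verts_D1a:
  assumes "2 \<le> r" "2 \<le> s"
  shows "card (pverts (D1a r s)) = r + s - 1"
proof -
  have "pverts (D1a r s) = Inl ` {1..r} \<union> Inr ` {2..s}"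
    using assms by (force simp: pverts_D1a glue_def)
  moreover have "card (Inl ` {1..r} \<union> Inr ` {2..s} :: (nat + nat) set) = r + (s - 1)"
    by (subst card_Un_disjoint) (auto simp: card_image)
  ultimately show ?thesis using assms by simp
qed

lemma parcs_D1a:
  assumes "2 \<le> r" "2 \<le> s"
  shows "parcs (D1a r s) =
    (\<lambda>i. (Inl i, Inl (i + 1))) ` {1..<r} \<union> {(Inl r, Inl 1), (Inl 1, Inr 2)} \<union>
    (\<lambda>i. (Inr i, Inr (i + 1))) ` {2..<s} \<union> {(Inr s, Inl 1), (Inl r, Inr 2)}"
proof -
  have c: "parcs (dicycle k) = (\<lambda>i. (i, i + 1)) ` {1..<k} \<union> {(k, 1)}" for k
    by (auto simp: dicycle_def)
  have s: "{1..<s} = insert 1 {2..<s}" using assms by auto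
  have g: "(\<lambda>i. (glue (Inr i), glue (Inr (i + 1)))) ` {2..<s} =
      (\<lambda>i. (Inr i, Inr (i + 1))) ` {2..<s}"
    by (intro image_cong) (auto simp: glue_def)
  have l: "map_prod glue glue ` map_prod Inl Inl ` parcs (dicycle r) =
      (\<lambda>i. (Inl i, Inl (i + 1))) ` {1..<r} \<union> {(Inl r, Inl 1)}"
    unfolding c image_Un image_image by (simp add: glue_def)
  have "map_prod glue glue ` map_prod Inr Inr ` parcs (dicycle s) =
      insert (glue (Inr 1), glue (Inr (1 + 1)))
        ((\<lambda>i. (glue (Inr i), glue (Inr (i + 1)))) ` {2..<s}) \<union> {(glue (Inr s), glue (Inr 1))}"
    unfolding c image_Un image_image s by simp
  also have "\<dots> = {(Inl 1, Inr 2)} \<union> (\<lambda>i. (Inr i, Inr (i + 1))) ` {2..<s} \<union> {(Inr s, Inl 1)}"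
    unfolding g using assms by (simp add: glue_def numeral_2_eq_2)
  finally show ?thesis
    unfolding D1a_def infinity_digraph_def by (auto simp only: image_Un l pair_pre_digraph.simps)
qed

lemma pair_digraph_D1a:
  assumes "2 \<le> r" "2 \<le> s"
  shows "pair_digraph (D1a r s)"
proof -
  have v: "pverts (D1a r s) = Inl ` {1..r} \<union> Inr ` {2..s}"
    using assms by (force simp: pverts_D1a glue_def)
  have sub: "parcs (D1a r s) \<subseteq> pverts (D1a r s) \<times> pverts (D1a r s)"
    unfolding v parcs_D1a[OF assms] using assms by auto
  have fin: "finite (pverts (D1a r s))" by (simp add: v)
  show ?thesis
  proof unfold_locales
    fix e assume e: "e \<in> parcs (D1a r s)"
    show "fst e \<in> pverts (D1a r s)" "snd e \<in> pverts (D1a r s)" using sub e by auto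
    show "fst e \<noteq> snd e" using e assms unfolding parcs_D1a[OF assms] by auto
  next
    show "finite (pverts (D1a r s))" by fact
    show "finite (parcs (D1a r s))" using finite_subset[OF sub] fin by simp
  qed
qed

text \<open>A class of digraphs is a set of digraphs over arbitrary types of vertices and arcs.\<close>

definition DCS :: "('a, 'b) pre_digraph set \<Rightarrow> bool" where
  "DCS \<C> \<longleftrightarrow> (\<forall>D \<in> \<C>. \<forall>H \<in> \<C>. card (verts D) = card (verts H) \<longrightarrow>
     complementarity_spectrum D = complementarity_spectrum H \<longrightarrow> digraph_iso D H)"

end

theory Submission
  imports Defs
begin

text \<open>
  Write \<open>n = r + s - 1\<close> for the number of vertices of \<open>D1a r s\<close>. The complementarity
  eigenvalues \<open>\<mu> > 1\<close> are the solutions of \<open>\<mu>^n = \<mu>^(s-1) + \<mu>^(r-1) + 1\<close>, and for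
  fixed \<open>n\<close> no \<open>\<mu> > 1\<close> can solve this equation for two different unordered pairs \<open>{r, s}\<close>.

  The equation comes from following a complementarity eigenvector \<open>x\<close> along the arcs. Every vertex
  other than the glued vertex \<open>1\<close> and the vertex \<open>r\<close> has a single out-neighbour, and so a positive
  entry of \<open>x\<close> is multiplied by \<open>\<mu>\<close> at each step until \<open>1\<close> or \<open>r\<close> is reached
  (\<open>complementary_chain\<close>). All these walks end up at \<open>1\<close>, so \<open>x\<close> is positive there. If \<open>x\<close>
  vanished on one of the two branches leaving \<open>1\<close>, a single directed cycle would remain and force
  \<open>\<mu>^k = 1\<close> for its length \<open>k\<close>; so for \<open>\<mu> > 1\<close> the vector is positive on both branches. Its
  values there are then determined by the value at \<open>1\<close>, and the equality at \<open>1\<close> becomes the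
  equation above (\<open>D1a_weights_imp_char_eq\<close>). Conversely, each solution gives an
  explicit positive eigenvector (\<open>char_eq_imp_D1a_weights\<close>). Since the equation has a solution
  above \<open>1\<close> (\<open>char_eq_solvable\<close>), equal spectra provide a common solution \<open>\<mu>\<close>.

  With \<open>n\<close> fixed, the numbers \<open>\<mu>^(r-1)\<close> and \<open>\<mu>^(s-1)\<close> have the known sum
  \<open>\<mu>^n - 1\<close> and the known product \<open>\<mu>^(n-1)\<close>, so they are determined up to order by Vieta, and
  \<open>r \<le> s\<close> fixes the order (\<open>sum_two_powers_inj\<close>).
\<close>

section \<open>Complementarity eigenvectors as vertex weights\<close>

definition out_sum :: "('a, 'b) pre_digraph \<Rightarrow> ('a \<Rightarrow> real) \<Rightarrow> 'a \<Rightarrow> real" where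
  "out_sum D x v = sum x {w \<in> verts D. (v, w) \<in> arcs_ends D}"

text \<open>
  For nonnegative \<open>x\<close> and \<open>A x \<ge> \<mu> x\<close>, the orthogonality condition on \<open>x\<close> is a sum of
  nonnegative terms and therefore holds vertex by vertex; this is the last conjunct.
\<close>

definition complementarity_weights :: "('a, 'b) pre_digraph \<Rightarrow> real \<Rightarrow> ('a \<Rightarrow> real) \<Rightarrow> bool" where
  "complementarity_weights D \<mu> x \<longleftrightarrow> (\<exists>v\<in>verts D. x v \<noteq> 0) \<and>
     (\<forall>v\<in>verts D. 0 \<le> x v \<and> \<mu> * x v \<le> out_sum D x v \<and> (x v = 0 \<or> out_sum D x v = \<mu> * x v))"

lemma adjacency_matrix_mult_vec:
  assumes vs: "vertex_labelling D vs" and y: "y \<in> carrier_vec (length vs)"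
    and xy: "\<And>j. j < length vs \<Longrightarrow> y $ j = x (vs ! j)" and i: "i < length vs"
  shows "(adjacency_matrix D vs *\<^sub>v y) $ i = out_sum D x (vs ! i)"
proof -
  let ?v = "vs ! i"
  have bij: "bij_betw ((!) vs) {..<length vs} (verts D)"
    using vs by (auto simp: vertex_labelling_def intro: bij_betw_nth)
  have "(adjacency_matrix D vs *\<^sub>v y) $ i
      = (\<Sum>j<length vs. (if (?v, vs ! j) \<in> arcs_ends D then 1 else 0) * y $ j)"
    using i y by (auto simp: adjacency_matrix_def scalar_prod_def lessThan_atLeast0 intro!: sum.cong)
  also have "\<dots> = (\<Sum>j<length vs. if (?v, vs ! j) \<in> arcs_ends D then x (vs ! j) else 0)"
    using xy by (intro sum.cong) auto
  also have "\<dots> = (\<Sum>w\<in>verts D. if (?v, w) \<in> arcs_ends D then x w else 0)"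
    by (rule sum.reindex_bij_betw[OF bij])
  also have "\<dots> = out_sum D x ?v"
    using bij_betw_finite[OF bij] by (simp add: out_sum_def sum.inter_filter)
  finally show ?thesis .
qed

lemma complementarity_eigenvector_iff:
  assumes vs: "vertex_labelling D vs" and y: "y \<in> carrier_vec (length vs)"
    and xy: "\<And>j. j < length vs \<Longrightarrow> y $ j = x (vs ! j)"
  shows "(y \<noteq> 0\<^sub>v (length vs) \<and> 0\<^sub>v (length vs) \<le> y \<and> \<mu> \<cdot>\<^sub>v y \<le> adjacency_matrix D vs *\<^sub>v y \<and>
          y \<bullet> (adjacency_matrix D vs *\<^sub>v y - \<mu> \<cdot>\<^sub>v y) = 0)
         \<longleftrightarrow> complementarity_weights D \<mu> x"
proof -
  let ?n = "length vs" and ?A = "adjacency_matrix D vs"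
  have dims: "dim_row ?A = ?n" "dim_vec y = ?n" using y by (auto simp: adjacency_matrix_def)
  have ball: "(\<forall>v\<in>verts D. P v) \<longleftrightarrow> (\<forall>i<?n. P (vs ! i))" for P
    using vs unfolding vertex_labelling_def by (metis all_set_conv_all_nth)
  have A: "(?A *\<^sub>v y) $ i = out_sum D x (vs ! i)" if "i < ?n" for i
    using adjacency_matrix_mult_vec[OF vs y xy that] .
  have nz: "y \<noteq> 0\<^sub>v ?n \<longleftrightarrow> (\<exists>v\<in>verts D. x v \<noteq> 0)"
    using ball[of "\<lambda>v. x v = 0"] dims xy by (auto simp: vec_eq_iff)
  have nn: "0\<^sub>v ?n \<le> y \<longleftrightarrow> (\<forall>v\<in>verts D. 0 \<le> x v)"
    using dims xy by (auto simp: less_eq_vec_def ball)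
  have le: "\<mu> \<cdot>\<^sub>v y \<le> ?A *\<^sub>v y \<longleftrightarrow> (\<forall>v\<in>verts D. \<mu> * x v \<le> out_sum D x v)"
    using dims xy A by (auto simp: less_eq_vec_def ball simp del: index_mult_mat_vec)
  have sp: "y \<bullet> (?A *\<^sub>v y - \<mu> \<cdot>\<^sub>v y)
      = (\<Sum>i<?n. x (vs ! i) * (out_sum D x (vs ! i) - \<mu> * x (vs ! i)))"
    using dims xy A
    by (auto simp: scalar_prod_def lessThan_atLeast0 simp del: index_mult_mat_vec intro!: sum.cong)
  have "y \<bullet> (?A *\<^sub>v y - \<mu> \<cdot>\<^sub>v y) = 0 \<longleftrightarrow> (\<forall>v\<in>verts D. x v = 0 \<or> out_sum D x v = \<mu> * x v)"
    if "\<forall>v\<in>verts D. 0 \<le> x v" "\<forall>v\<in>verts D. \<mu> * x v \<le> out_sum D x v"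
    using that unfolding sp ball by (subst sum_nonneg_eq_0_iff) auto
  then show ?thesis
    unfolding nz nn le complementarity_weights_def by blast
qed

lemma complementarity_spectrum_iff_weights:
  assumes "finite (verts D)"
  shows "\<mu> \<in> complementarity_spectrum D \<longleftrightarrow> (\<exists>x. complementarity_weights D \<mu> x)"
proof -
  obtain vs where vs: "vertex_labelling D vs"
    using finite_distinct_list[OF assms] by (auto simp: vertex_labelling_def)
  let ?n = "length vs" and ?A = "adjacency_matrix D vs"
  let ?ev = "\<lambda>y. y \<noteq> 0\<^sub>v ?n \<and> 0\<^sub>v ?n \<le> y \<and> \<mu> \<cdot>\<^sub>v y \<le> ?A *\<^sub>v y \<and> y \<bullet> (?A *\<^sub>v y - \<mu> \<cdot>\<^sub>v y) = 0"
  have "\<mu> \<in> complementarity_spectrum D \<longleftrightarrow> (\<exists>y\<in>carrier_vec ?n. ?ev y)"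
    unfolding complementarity_spectrum_eq[OF vs] complementarity_eigenvalue_def
    by (auto simp: adjacency_matrix_def)
  also have "\<dots> \<longleftrightarrow> (\<exists>x. complementarity_weights D \<mu> x)"
  proof
    assume "\<exists>y\<in>carrier_vec ?n. ?ev y"
    then obtain y where y: "y \<in> carrier_vec ?n" "?ev y" by blast
    have "y $ j = y $ the_inv_into {..<?n} ((!) vs) (vs ! j)" if "j < ?n" for j
      using that vs by (subst the_inv_into_f_f) (auto simp: vertex_labelling_def inj_on_nth)
    then show "\<exists>x. complementarity_weights D \<mu> x"
      using complementarity_eigenvector_iff[OF vs y(1),
          where x = "\<lambda>v. y $ the_inv_into {..<?n} ((!) vs) v"] y(2)
      by blast
  next
    assume "\<exists>x. complementarity_weights D \<mu> x"
    then obtain x where "complementarity_weights D \<mu> x" ..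
    then have "?ev (vec ?n (\<lambda>j. x (vs ! j)))"
      by (subst complementarity_eigenvector_iff[OF vs, where x = x]) auto
    then show "\<exists>y\<in>carrier_vec ?n. ?ev y" by (intro bexI) auto
  qed
  finally show ?thesis .
qed

text \<open>
  Transporting a vertex labelling along an isomorphism leaves the adjacency matrix unchanged.
\<close>

lemma complementarity_spectrum_iso:
  assumes "digraph_iso G H" and fin: "finite (verts G)"
  shows "complementarity_spectrum G = complementarity_spectrum H"
proof -
  obtain f where f: "pre_digraph.digraph_isomorphism G f" and H: "H = app_iso f G"
    using assms by (auto simp: digraph_iso_def)
  have inj: "inj_on (iso_verts f) (verts G)" and wf: "wf_digraph G"
    using f by (auto simp: pre_digraph.digraph_isomorphism_def)
  obtain vs where vs: "vertex_labelling G vs"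
    using finite_distinct_list[OF fin] by (auto simp: vertex_labelling_def)
  have ws: "vertex_labelling H (map (iso_verts f) vs)"
    using vs inj by (auto simp: vertex_labelling_def H distinct_map)
  have ends: "(u, v) \<in> arcs_ends G \<Longrightarrow> u \<in> verts G \<and> v \<in> verts G" for u v
    using wf by (auto simp: arcs_ends_conv wf_digraph_def)
  have "(iso_verts f u, iso_verts f v) \<in> arcs_ends H \<longleftrightarrow> (u, v) \<in> arcs_ends G"
    if "u \<in> verts G" "v \<in> verts G" for u v
  proof
    assume "(iso_verts f u, iso_verts f v) \<in> arcs_ends H"
    then obtain u' v' where "(u', v') \<in> arcs_ends G"
      "iso_verts f u' = iso_verts f u" "iso_verts f v' = iso_verts f v"
      unfolding H wf_digraph.arcs_ends_app_iso_eq[OF wf f] by (auto simp del: arcs_app_iso)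
    then show "(u, v) \<in> arcs_ends G"
      using ends that inj by (metis inj_onD)
  next
    assume "(u, v) \<in> arcs_ends G"
    then show "(iso_verts f u, iso_verts f v) \<in> arcs_ends H"
      unfolding H wf_digraph.arcs_ends_app_iso_eq[OF wf f] by (rule rev_image_eqI) simp
  qed
  moreover have "vs ! i \<in> verts G" if "i < length vs" for i
    using that vs unfolding vertex_labelling_def by (metis nth_mem)
  ultimately have "adjacency_matrix H (map (iso_verts f) vs) = adjacency_matrix G vs"
    by (intro eq_matI) (simp_all add: adjacency_matrix_def)
  then show ?thesis
    by (simp add: complementarity_spectrum_eq[OF vs] complementarity_spectrum_eq[OF ws])
qed

text \<open>
  Applied to consecutive vertices with a single out-neighbour each: a positive weight makes the
  next one positive too, so complementarity turns every inequality on the way into an equality.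
\<close>

lemma complementary_chain:
  fixes f :: "nat \<Rightarrow> real"
  assumes "0 < \<mu>" "a \<le> b" "0 < f a"
    and "\<And>i. a \<le> i \<Longrightarrow> i < b \<Longrightarrow> f i = 0 \<or> f (Suc i) = \<mu> * f i"
  shows "f b = \<mu> ^ (b - a) * f a"
  using assms(2,4)
proof (induction b rule: dec_induct)
  case (step k)
  have fk: "f k = \<mu> ^ (k - a) * f a" using step by simp
  then have "f k \<noteq> 0" using assms(1,3) by simp
  then have "f (Suc k) = \<mu> * f k" using step.prems[of k] step.hyps by simp
  then show ?case using fk step.hyps by (simp add: Suc_diff_le)
qed simp

section \<open>The complementarity eigenvalues above 1\<close>

lemma pverts_D1a_split:
  assumes "2 \<le> r" "2 \<le> s"
  shows "pverts (D1a r s) = insert (Inl 1) (Inl ` {2..r} \<union> Inr ` {2..s})"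
  using assms by (force simp: pverts_D1a glue_def)

lemma out_sum_D1a:
  assumes "2 \<le> r" "2 \<le> s"
  shows "out_sum (with_proj (D1a r s)) x (Inl 1) = x (Inl 2) + x (Inr 2)"
    and "i \<in> {2..r} \<Longrightarrow> out_sum (with_proj (D1a r s)) x (Inl i)
           = (if i = r then x (Inl 1) + x (Inr 2) else x (Inl (Suc i)))"
    and "j \<in> {2..s} \<Longrightarrow> out_sum (with_proj (D1a r s)) x (Inr j)
           = (if j = s then x (Inl 1) else x (Inr (Suc j)))"
proof -
  let ?N = "\<lambda>v. {w \<in> pverts (D1a r s). (v, w) \<in> parcs (D1a r s)}"
  note D = pverts_D1a_split[OF assms] parcs_D1a[OF assms]
  have "?N (Inl 1) = {Inl 2, Inr 2}"
    unfolding D using assms by auto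
  then show "out_sum (with_proj (D1a r s)) x (Inl 1) = x (Inl 2) + x (Inr 2)"
    by (simp add: out_sum_def)
  show "out_sum (with_proj (D1a r s)) x (Inl i)
      = (if i = r then x (Inl 1) + x (Inr 2) else x (Inl (Suc i)))" if "i \<in> {2..r}"
  proof -
    have "?N (Inl i) = (if i = r then {Inl 1, Inr 2} else {Inl (Suc i)})"
      unfolding D using assms that by auto
    then show ?thesis by (simp add: out_sum_def)
  qed
  show "out_sum (with_proj (D1a r s)) x (Inr j) = (if j = s then x (Inl 1) else x (Inr (Suc j)))"
    if "j \<in> {2..s}"
  proof -
    have "?N (Inr j) = (if j = s then {Inl 1} else {Inr (Suc j)})"
      unfolding D using assms that by auto
    then show ?thesis by (simp add: out_sum_def)
  qed
qed

text \<open>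
  The equation says that \<open>\<mu>\<close> is a root of the characteristic polynomial
  \<open>t^n - t^(n-r) - t^(n-s) - 1\<close> of \<open>D1a r s\<close>, whose last three terms stem from the directed cycles,
  of lengths \<open>r\<close>, \<open>s\<close> and \<open>n = r + s - 1\<close>, no two of which are disjoint.
\<close>

lemma D1a_weights_imp_char_eq:
  assumes r: "2 \<le> r" and s: "2 \<le> s" and \<mu>: "1 < \<mu>"
    and w: "complementarity_weights (with_proj (D1a r s)) \<mu> x"
  shows "\<mu> ^ (r + s - 1) = \<mu> ^ (s - 1) + \<mu> ^ (r - 1) + 1"
proof -
  note V = pverts_D1a_split[OF r s] and O = out_sum_D1a[OF r s]
  define c Y Z where "c = x (Inl 1)" and "Y = x (Inr 2)" and "Z = x (Inl 2)"
  have nn: "0 \<le> x v"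
    and eq: "x v = 0 \<or> out_sum (with_proj (D1a r s)) x v = \<mu> * x v"
    if "v \<in> pverts (D1a r s)" for v
    using w that by (auto simp: complementarity_weights_def)
  have nonneg: "0 \<le> c" "0 \<le> Y" "0 \<le> Z"
    using nn r s by (auto simp: V c_def Y_def Z_def)
  \<comment> \<open>Each branch is prolonged by one entry, the out-sum at its last vertex.\<close>
  have R: "c = \<mu> ^ (s + 1 - j) * x (Inr j)" if "j \<in> {2..s}" "0 < x (Inr j)" for j
  proof -
    let ?f = "\<lambda>k. if k \<le> s then x (Inr k) else c"
    have "?f (s + 1) = \<mu> ^ (s + 1 - j) * ?f j"
    proof (rule complementary_chain)
      show "?f i = 0 \<or> ?f (Suc i) = \<mu> * ?f i" if "j \<le> i" "i < s + 1" for i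
        using eq[of "Inr i"] O(3)[of i x] that \<open>j \<in> {2..s}\<close>
        by (auto simp: V c_def split: if_splits)
    qed (use that \<mu> in auto)
    then show ?thesis using that by simp
  qed
  have L: "c + Y = \<mu> ^ (r + 1 - i) * x (Inl i)" if "i \<in> {2..r}" "0 < x (Inl i)" for i
  proof -
    let ?f = "\<lambda>k. if k \<le> r then x (Inl k) else c + Y"
    have "?f (r + 1) = \<mu> ^ (r + 1 - i) * ?f i"
    proof (rule complementary_chain)
      show "?f k = 0 \<or> ?f (Suc k) = \<mu> * ?f k" if "i \<le> k" "k < r + 1" for k
        using eq[of "Inl k"] O(2)[of k x] that \<open>i \<in> {2..r}\<close>
        by (auto simp: V c_def Y_def split: if_splits)
    qed (use that \<mu> in auto)
    then show ?thesis using that by simp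
  qed
  have RY: "c = \<mu> ^ (s - 1) * Y" if "0 < Y"
    using R[of 2] that s by (simp add: Y_def eval_nat_numeral)
  have LZ: "c + Y = \<mu> ^ (r - 1) * Z" if "0 < Z"
    using L[of 2] that r by (simp add: Z_def eval_nat_numeral)
  have pos: "0 < \<mu> ^ k" for k using \<mu> by simp
  have "c \<noteq> 0"
  proof
    assume c0: "c = 0"
    have x0: "x (Inr j) = 0" if "j \<in> {2..s}" for j
      using R[OF that] nn[of "Inr j"] pos[of "s + 1 - j"] c0 that \<mu> by (force simp: V)
    then have "Y = 0" using s by (simp add: Y_def)
    have "x (Inl i) = 0" if "i \<in> {2..r}" for i
      using L[OF that] nn[of "Inl i"] c0 \<open>Y = 0\<close> that \<mu> by (force simp: V)
    with x0 c0 w show False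
      by (auto simp: complementarity_weights_def V c_def)
  qed
  then have c: "0 < c" using nonneg by simp
  have ZY: "Z + Y = \<mu> * c"
    using eq[of "Inl 1"] O(1)[of x] \<open>c \<noteq> 0\<close> by (simp add: V c_def Y_def Z_def)
  have no_cycle: "c \<noteq> \<mu> ^ k * (\<mu> * c)" for k
  proof -
    have "1 < \<mu> * \<mu> ^ k" using \<mu> by (metis power_Suc one_less_power zero_less_Suc)
    then show ?thesis using c by (auto simp: mult.left_commute mult.commute)
  qed
  have "Y \<noteq> 0"
  proof
    assume "Y = 0"
    then have "Z = \<mu> * c" using ZY by simp
    moreover from this have "0 < Z" using c \<mu> by simp
    ultimately have "c = \<mu> ^ (r - 1) * (\<mu> * c)" using LZ \<open>Y = 0\<close> by (metis add_0_right)
    then show False using no_cycle by blast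
  qed
  have "Z \<noteq> 0"
  proof
    assume "Z = 0"
    then have "Y = \<mu> * c" using ZY by simp
    moreover from this have "0 < Y" using c \<mu> by simp
    ultimately have "c = \<mu> ^ (s - 1) * (\<mu> * c)" using RY by metis
    then show False using no_cycle by blast
  qed
  have Y: "0 < Y" and Z: "0 < Z" using nonneg \<open>Y \<noteq> 0\<close> \<open>Z \<noteq> 0\<close> by auto
  define P Q where "P = \<mu> ^ (s - 1)" and "Q = \<mu> ^ (r - 1)"
  have cP: "c = P * Y" and cQ: "c + Y = Q * Z" using RY[OF Y] LZ[OF Z] by (auto simp: P_def Q_def)
  have "Y * (P + Q + 1) = Q * (Z + Y)" using cP cQ by (simp add: algebra_simps)
  also have "\<dots> = Y * (\<mu> * Q * P)" unfolding ZY cP by (simp add: algebra_simps)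
  finally have "\<mu> * Q * P = P + Q + 1" using Y by simp
  moreover have "r + s - 1 = Suc ((r - 1) + (s - 1))" using r s by simp
  then have "\<mu> ^ (r + s - 1) = \<mu> * Q * P" by (simp only: P_def Q_def power_Suc power_add mult.assoc)
  ultimately show ?thesis by (simp add: P_def Q_def)
qed

text \<open>
  The weights are those which the equations along the two branches force, scaled to have the
  value \<open>\<mu>^n\<close> at vertex \<open>1\<close>; they are stated with positive exponents only.
\<close>

lemma char_eq_imp_D1a_weights:
  assumes r: "2 \<le> r" and s: "2 \<le> s" and \<mu>: "1 < \<mu>"
    and ch: "\<mu> ^ (r + s - 1) = \<mu> ^ (s - 1) + \<mu> ^ (r - 1) + 1"
  shows "\<exists>x. complementarity_weights (with_proj (D1a r s)) \<mu> x"
proof -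
  note V = pverts_D1a_split[OF r s] and O = out_sum_D1a[OF r s]
  define x :: "nat + nat \<Rightarrow> real" where
    "x v = (case v of
        Inl i \<Rightarrow> if i = 1 then \<mu> ^ (r + s - 1) else (\<mu> ^ (s - 1) + 1) * \<mu> ^ (i - 1)
      | Inr j \<Rightarrow> \<mu> ^ (r + j - 2))" for v
  have pos: "0 < x v" for v
    using \<mu> by (auto simp: x_def add_pos_pos split: sum.split)
  have "out_sum (with_proj (D1a r s)) x v = \<mu> * x v" if "v \<in> pverts (D1a r s)" for v
  proof -
    consider (one) "v = Inl 1" | (left) i where "v = Inl i" "i \<in> {2..r}"
      | (right) j where "v = Inr j" "j \<in> {2..s}"
      using \<open>v \<in> pverts (D1a r s)\<close> unfolding V by blast
    then show ?thesis
    proof cases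
      case one
      have "x (Inl 2) + x (Inr 2) = \<mu> * (\<mu> ^ (s - 1) + 1) + \<mu> ^ r"
        by (simp add: x_def)
      also have "\<mu> ^ r = \<mu> * \<mu> ^ (r - 1)"
        using r by (simp add: power_eq_if)
      finally show ?thesis unfolding one O(1) 
        by (simp add: x_def ch algebra_simps del: One_nat_def)
    next
      case (left i)
      show ?thesis
      proof (cases "i = r")
        case True
        have "r + s - 1 = (s - 1) + r" using s by simp
        then have "\<mu> ^ (r + s - 1) = \<mu> ^ (s - 1) * \<mu> ^ r" by (simp only: power_add)
        moreover have "\<mu> ^ r = \<mu> * \<mu> ^ (r - 1)"
          using r by (simp add: power_eq_if)
        ultimately show ?thesis
          unfolding left(1) O(2)[OF left(2)] using True r by (simp add: x_def algebra_simps)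
      next
        case False
        have "\<mu> ^ i = \<mu> * \<mu> ^ (i - 1)"
          using left(2) by (simp add: power_eq_if)
        then show ?thesis
          unfolding left(1) O(2)[OF left(2)] using False left(2) by (simp add: x_def)
      qed
    next
      case (right j)
      have "\<mu> ^ (r + j - 1) = \<mu> * \<mu> ^ (r + j - 2)"
        using r by (simp add: power_eq_if numeral_2_eq_2)
      then show ?thesis
        unfolding right(1) O(3)[OF right(2)] by (auto simp: x_def)
    qed
  qed
  moreover have "\<exists>v\<in>pverts (D1a r s). x v \<noteq> 0" using pos[of "Inl 1"] by (auto simp: V)
  ultimately have "complementarity_weights (with_proj (D1a r s)) \<mu> x"
    using pos by (auto simp: complementarity_weights_def less_imp_le)
  then show ?thesis by (rule exI[where x = x])
qed

lemma finite_pverts_D1a: "finite (pverts (D1a r s))"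
  by (simp add: pverts_D1a)

lemma complementarity_spectrum_D1a_above_1:
  assumes "2 \<le> r" "2 \<le> s" "1 < \<mu>"
  shows "\<mu> \<in> complementarity_spectrum (with_proj (D1a r s)) \<longleftrightarrow>
    \<mu> ^ (r + s - 1) = \<mu> ^ (s - 1) + \<mu> ^ (r - 1) + 1"
  using D1a_weights_imp_char_eq[OF assms] char_eq_imp_D1a_weights[OF assms]
  by (subst complementarity_spectrum_iff_weights) (auto simp: finite_pverts_D1a)

text \<open>The difference of the two sides changes sign between \<open>1\<close> and \<open>2\<close>.\<close>

lemma char_eq_solvable:
  assumes r: "2 \<le> r" and s: "2 \<le> s"
  obtains \<mu> :: real where "1 < \<mu>" "\<mu> ^ (r + s - 1) = \<mu> ^ (s - 1) + \<mu> ^ (r - 1) + 1"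
proof -
  let ?f = "\<lambda>t::real. t ^ (r + s - 1) - t ^ (s - 1) - t ^ (r - 1) - 1"
  have "1 \<le> (2::real) ^ (r - 1)" "1 \<le> (2::real) ^ (s - 1)" by simp_all
  then have "0 \<le> ((2::real) ^ (r - 1) - 1) * (2 ^ (s - 1) - 1)" by simp
  moreover have "2 \<le> (2::real) ^ (r - 1) * 2 ^ (s - 1)"
  proof -
    have "(2::real) ^ 1 \<le> 2 ^ ((r - 1) + (s - 1))" using r s by (intro power_increasing) auto
    then show ?thesis by (simp only: power_add power_one_right)
  qed
  moreover have "r + s - 1 = Suc ((r - 1) + (s - 1))" using r s by simp
  then have "(2::real) ^ (r + s - 1) = 2 * (2 ^ (r - 1) * 2 ^ (s - 1))"
    by (simp only: power_Suc power_add)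
  ultimately have "0 \<le> ?f 2" by (simp add: algebra_simps)
  moreover have "?f 1 \<le> 0" by simp
  moreover have "continuous_on {1..2} ?f" by (intro continuous_intros)
  ultimately obtain \<mu> where \<mu>: "1 \<le> \<mu>" "?f \<mu> = 0"
    using IVT'[of ?f 1 0 2] by (metis one_le_numeral)
  from \<mu>(2) have "\<mu> \<noteq> 1" by auto
  with \<mu> show ?thesis by (intro that[of \<mu>]) auto
qed

section \<open>The complementarity spectrum determines the digraph\<close>

text \<open>Both pairs of powers are the roots of one and the same monic quadratic polynomial.\<close>

lemma sum_two_powers_inj:
  fixes t :: real
  assumes t: "1 < t" and ord: "a \<le> b" "a' \<le> b'" and sum: "a + b = a' + b'"
    and eq: "t ^ a + t ^ b = t ^ a' + t ^ b'"
  shows "a = a'"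
proof -
  have "t ^ a * t ^ b = t ^ a' * t ^ b'" using sum by (metis power_add)
  then have "(t ^ a - t ^ a') * (t ^ a - t ^ b') = t ^ a * (t ^ a - (t ^ a' + t ^ b') + t ^ b)"
    by (simp add: algebra_simps)
  also have "\<dots> = 0" by (simp flip: eq)
  finally have "a = a' \<or> a = b'" using t by auto
  then show ?thesis using ord sum by auto
qed

theorem corollary3p7:
  shows "DCS (Type1a :: ('a, 'b) pre_digraph set)"
  unfolding DCS_def
proof (intro ballI impI)
  fix D H :: "('a, 'b) pre_digraph"
  assume "D \<in> Type1a" "H \<in> Type1a" and card: "card (verts D) = card (verts H)"
    and spec: "complementarity_spectrum D = complementarity_spectrum H"
  then obtain r s r' s' where D: "digraph D" "2 \<le> r" "r \<le> s" "digraph_iso D (with_proj (D1a r s))"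
    and H: "digraph H" "2 \<le> r'" "r' \<le> s'" "digraph_iso H (with_proj (D1a r' s'))"
    by (auto simp: Type1a_def)
  have s: "2 \<le> s" "2 \<le> s'" using D H by auto
  have fin: "finite (verts D)" "finite (verts H)" and wf: "wf_digraph H"
    using D(1) H(1)
    by (auto simp: digraph_def fin_digraph_def fin_digraph_axioms_def loopfree_digraph_def)
  have card_iso: "card (verts G) = card (verts K)" if "digraph_iso G K"
    for G :: "('a, 'b) pre_digraph" and K :: "(nat + nat, (nat + nat) \<times> (nat + nat)) pre_digraph"
    using that by (auto simp: digraph_iso_def pre_digraph.digraph_isomorphism_def card_image)
  have n: "r + s - 1 = r' + s' - 1"
    using card_iso[OF D(4)] card_iso[OF H(4)] card card_verts_D1a[of r s] card_verts_D1a[of r' s']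
      D(2) H(2) s by simp
  have "complementarity_spectrum (with_proj (D1a r s))
      = complementarity_spectrum (with_proj (D1a r' s'))"
    using complementarity_spectrum_iso[OF D(4) fin(1)] complementarity_spectrum_iso[OF H(4) fin(2)]
      spec by simp
  moreover obtain \<mu> :: real where \<mu>: "1 < \<mu>" "\<mu> ^ (r + s - 1) = \<mu> ^ (s - 1) + \<mu> ^ (r - 1) + 1"
    using char_eq_solvable[OF D(2) s(1)] .
  ultimately have "\<mu> ^ (r' + s' - 1) = \<mu> ^ (s' - 1) + \<mu> ^ (r' - 1) + 1"
    using complementarity_spectrum_D1a_above_1 D(2) H(2) s by metis
  then have "\<mu> ^ (r - 1) + \<mu> ^ (s - 1) = \<mu> ^ (r' - 1) + \<mu> ^ (s' - 1)"
    using \<mu>(2) n by simp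
  then have "r - 1 = r' - 1"
  proof (rule sum_two_powers_inj[OF \<mu>(1), rotated -1])
    show "r - 1 \<le> s - 1" "r' - 1 \<le> s' - 1" "(r - 1) + (s - 1) = (r' - 1) + (s' - 1)"
      using D(2,3) H(2,3) n by auto
  qed
  then have "r = r'" "s = s'" using D(2) H(2) n s by auto
  then show "digraph_iso D H"
    using digraph_iso_trans[OF D(4)] digraph_iso_swap[OF wf H(4)] by simp
qed

end
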